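(* There is a constant $c$ such that, if $\Delta\sim\mathcal{U}(n)$ with $n$ even, then for any natural number $k$, $$\mathbb{P}(\chi(\Delta)=k)\leq c\,n^{1/4}\,2^{-n/2}.$$
   Context: A simplicial complex on $n$ vertices is a collection $\Delta$ of non-empty subsets (faces) of $[n]=\{1,\dots,n\}$ such that if $x\in\Delta$ and $\emptyset\neq y\subseteq x$ then $y\in\Delta$. $\mathcal{U}(n)$ is the uniform probability distribution on the set of all simplicial complexes on $n$ vertices. The Euler characteristic is $\chi(\Delta)=\sum_{x\in\Delta}(-1)^{|x|-1}$, i.e. the alternating sum of the numbers of faces of dimension $0,1,2,\dots$, where a face $x$ has dimension $|x|-1$. *)

theory Defs
  imports "HOL-Probability.Probability"
begin

definition simplicial_complexes :: "nat \<Rightarrow> nat set set set" where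
  "simplicial_complexes n =
     {\<Delta>. (\<forall>x\<in>\<Delta>. x \<noteq> {} \<and> x \<subseteq> {1..n}) \<and>
         (\<forall>x\<in>\<Delta>. \<forall>y. y \<noteq> {} \<and> y \<subseteq> x \<longrightarrow> y \<in> \<Delta>)}"

text \<open>The next two facts make \<^term>\<open>pmf_of_set (simplicial_complexes n)\<close> the genuine uniform
  distribution (\<^const>\<open>pmf_of_set\<close> is only specified on finite non-empty sets).\<close>

lemma finite_simplicial_complexes: "finite (simplicial_complexes n)"
proof (rule finite_subset)
  show "simplicial_complexes n \<subseteq> Pow (Pow {1..n})"
    by (auto simp: simplicial_complexes_def)
qed simp

lemma simplicial_complexes_nonempty: "simplicial_complexes n \<noteq> {}"
proof -
  have "{} \<in> simplicial_complexes n"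
    by (simp add: simplicial_complexes_def)
  then show ?thesis by blast
qed

definition uniform_complex :: "nat \<Rightarrow> nat set set pmf" where
  "uniform_complex n = pmf_of_set (simplicial_complexes n)"

text \<open>Faces are non-empty, so the truncated subtraction \<^term>\<open>card x - 1\<close> is the dimension
  of the face \<^term>\<open>x\<close>.\<close>

definition euler_char :: "nat set set \<Rightarrow> int" where
  "euler_char \<Delta> = (\<Sum>x\<in>\<Delta>. (-1) ^ (card x - 1))"

end

theory Submission
  imports Defs
begin

text \<open>
  Fix the faces of even size. Every covering relation of the face poset joins an even and an odd set,
  so the odd sets that are not thereby forced in or out are independent fair coin flips, all
  contributing with the same sign to \<open>\<chi>\<close>. If there are \<open>M\<close> of them, each value of \<open>\<chi>\<close> has conditional
  probability \<open>O(1 / sqrt M)\<close>; the same holds with the parities exchanged. A maximal face is always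
  free in the class of its parity. Hence it suffices that, with \<open>N\<close> the middle binomial coefficient,
  all but a fraction \<open>O(1 / sqrt N)\<close> of the complexes have at least a constant times \<open>N\<close> maximal faces.

  A complex is determined by its antichain of maximal faces, and there are at least \<open>2 ^ N\<close> complexes,
  so we bound the antichains of size at most \<open>N / 100\<close>. They are counted by the hard-core partition
  function \<open>\<Sum> x ^ |I|\<close> over antichains \<open>I\<close>. A family of more than \<open>2 * N\<close> proper subsets of \<open>{1..n}\<close> has a
  member comparable to more than about \<open>n / 4\<close> others (average over random maximal chains), so branching
  on such members bounds the partition function by \<open>(1 + x) ^ (2 * N + 1) * \<beta> ^ (2 ^ n)\<close> with
  \<open>\<beta> - 1\<close> of order \<open>1 / sqrt n\<close>, which is a small exponential in \<open>N\<close>.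
\<close>

section \<open>Supersaturation in the Boolean lattice\<close>

text \<open>\<open>1 / (card B choose card A)\<close> is the probability that a uniformly random
  maximal chain of subsets of \<open>B\<close> passes through \<open>A\<close>; the identity
  conditions on the coatom \<open>B - {i}\<close> of the chain.\<close>

lemma inverse_binomial_eq_average:
  assumes "finite B" "A \<subset> B"
  shows "1 / real (card B choose card A)
    = (\<Sum>i\<in>B - A. 1 / real (card (B - {i}) choose card A)) / real (card B)"
proof -
  have fA: "finite A" using assms by (meson finite_subset psubset_imp_subset)
  have lt: "card A < card B" using assms by (simp add: psubset_card_mono)
  have cd: "card (B - A) = card B - card A" using assms fA by (simp add: card_Diff_subset)
  have "(\<Sum>i\<in>B - A. 1 / real (card (B - {i}) choose card A))
      = (\<Sum>i\<in>B - A. 1 / real ((card B - 1) choose card A))"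
    using assms by (intro sum.cong) auto
  also have "\<dots> = real (card B - card A) / real ((card B - 1) choose card A)"
    by (simp add: cd)
  finally have s: "(\<Sum>i\<in>B - A. 1 / real (card (B - {i}) choose card A))
      = real (card B - card A) / real ((card B - 1) choose card A)" .
  have "(card B - card A) * (card B choose card A) = card B * ((card B - 1) choose card A)"
    by (rule binomial_absorb_comp)
  then have e: "real (card B - card A) * real (card B choose card A)
      = real (card B) * real ((card B - 1) choose card A)"
    by (metis of_nat_mult)
  have "0 < (card B choose card A)" "0 < ((card B - 1) choose card A)" "0 < card B"
    using lt by (auto simp: zero_less_binomial_iff)
  then show ?thesis unfolding s using e by (simp add: field_simps)
qed

text \<open>For \<open>X\<close> the number of members of \<open>F\<close> on a uniformly random maximal chain of subsets of \<open>B\<close>, the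
  left-hand side is \<open>E[X] - E[X choose 2]\<close>.\<close>

lemma chain_inequality:
  fixes F :: "'a set set"
  assumes "finite B"
  shows "(\<Sum>A\<in>{A\<in>F. A \<subseteq> B}. 1 / real (card B choose card A) *
            (1 - (\<Sum>A'\<in>{A'\<in>F. A' \<subset> A}. 1 / real (card A choose card A')))) \<le> 1"
  using assms
proof (induction B rule: finite_psubset_induct)
  case (psubset B)
  define w where "w A B = 1 / real (card B choose card A)" for A B :: "'a set"
  define g where "g A = 1 - (\<Sum>A'\<in>{A'\<in>F. A' \<subset> A}. w A' A)" for A
  have w0: "w A B \<ge> 0" for A B by (simp add: w_def)
  have fin: "finite {A\<in>F. A \<subset> B}" "finite {A\<in>F. A \<subseteq> B}"
    by (rule finite_subset[of _ "Pow B"]; use psubset in auto)+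
  have IH: "(\<Sum>A\<in>{A\<in>F. A \<subseteq> C}. w A C * g A) \<le> 1" if "C \<subset> B" for C
    using psubset.IH[OF that] by (simp add: w_def g_def)
  have "(\<Sum>A\<in>{A\<in>F. A \<subseteq> B}. w A B * g A) \<le> 1"
  proof (cases "B \<in> F")
    case True
    have eq: "{A\<in>F. A \<subseteq> B} = insert B {A\<in>F. A \<subset> B}" using True by auto
    have "(\<Sum>A\<in>{A\<in>F. A \<subseteq> B}. w A B * g A) = w B B * g B + (\<Sum>A\<in>{A\<in>F. A \<subset> B}. w A B * g A)"
      unfolding eq using fin by (subst sum.insert) auto
    also have "w B B = 1" by (simp add: w_def)
    \<comment> \<open>Bounding \<open>g A\<close> by 1 leaves the sum of \<open>w A B\<close>, which
      is exactly what \<open>g B\<close> subtracts from 1.\<close>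
    also have "(\<Sum>A\<in>{A\<in>F. A \<subset> B}. w A B * g A) \<le> (\<Sum>A\<in>{A\<in>F. A \<subset> B}. w A B)"
    proof (intro sum_mono mult_left_le w0)
      show "g A \<le> 1" for A unfolding g_def using sum_nonneg[of _ "\<lambda>A'. w A' A"] w0 by simp
    qed
    finally show ?thesis by (simp add: g_def)
  next
    case False
    show ?thesis
    proof (cases "B = {}")
      case True
      then have "{A\<in>F. A \<subseteq> B} = {}" using False by auto
      then show ?thesis by (simp only: sum.empty zero_le_one)
    next
      case ne: False
      have pos: "real (card B) > 0" using ne psubset by (simp add: card_gt_0_iff)
      have eq: "{A\<in>F. A \<subseteq> B} = {A\<in>F. A \<subset> B}" using False by auto
      \<comment> \<open>For \<open>B\<close> outside \<open>F\<close>, the sum is the average over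
        all coatoms \<open>B - {i}\<close> of the sums bounded by the induction hypothesis.\<close>
      have "(\<Sum>A\<in>{A\<in>F. A \<subset> B}. w A B * g A)
          = (\<Sum>A\<in>{A\<in>F. A \<subset> B}. (\<Sum>i\<in>B - A. w A (B - {i}) * g A) / real (card B))"
        using inverse_binomial_eq_average[OF psubset.hyps(1)]
        by (intro sum.cong refl) (simp add: w_def sum_distrib_right)
      also have "\<dots> = (\<Sum>A\<in>{A\<in>F. A \<subset> B}. \<Sum>i\<in>{i\<in>B. i \<notin> A}. w A (B - {i}) * g A) / real (card B)"
        by (simp add: sum_divide_distrib set_diff_eq)
      also have "(\<Sum>A\<in>{A\<in>F. A \<subset> B}. \<Sum>i\<in>{i\<in>B. i \<notin> A}. w A (B - {i}) * g A)
          = (\<Sum>i\<in>B. \<Sum>A\<in>{A\<in>{A\<in>F. A \<subset> B}. i \<notin> A}. w A (B - {i}) * g A)"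
        using fin psubset by (intro sum.swap_restrict) auto
      also have "\<dots> = (\<Sum>i\<in>B. \<Sum>A\<in>{A\<in>F. A \<subseteq> B - {i}}. w A (B - {i}) * g A)"
        by (intro sum.cong refl) auto
      also have "\<dots> \<le> (\<Sum>i\<in>B. 1)"
        by (intro sum_mono IH) auto
      finally show ?thesis using pos by (simp add: eq divide_right_mono)
    qed
  qed
  then show ?case by (simp add: w_def g_def)
qed

lemma le_binomial:
  assumes "0 < k" "k < n"
  shows "n \<le> n choose k"
proof -
  have "n choose 1 \<le> n choose k"
  proof (cases "2 * k \<le> n")
    case True
    then show ?thesis using assms by (intro binomial_mono) auto
  next
    case False
    have "n choose 1 \<le> n choose (n - k)" using assms False by (intro binomial_mono) auto
    then show ?thesis using assms by (simp add: binomial_symmetric[of k n])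
  qed
  then show ?thesis by simp
qed

text \<open>With so few comparable partners per member, a random maximal chain contains on average
  at most half as many comparable pairs as members. By \<open>chain_inequality\<close> it then meets
  at most 2 members on average, and each is met with probability at least the inverse of the middle
  binomial coefficient.\<close>

lemma card_le_of_comparable_le:
  fixes F :: "'a set set"
  assumes X: "finite X" and F: "F \<subseteq> Pow X" "X \<notin> F"
    and deg: "\<And>v. v \<in> F \<Longrightarrow> card {u\<in>F. u \<subset> v \<or> v \<subset> u} \<le> d" and d: "4 * d \<le> card X"
  shows "card F \<le> 2 * (card X choose (card X div 2))"
proof -
  define n where "n = card X"
  define w where "w A = 1 / real (n choose card A)" for A :: "'a set"
  define w2 where "w2 A' A = 1 / real (card A choose card A')" for A' A :: "'a set"
  have finF: "finite F" using X F by (meson finite_Pow_iff finite_subset)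
  have fin: "finite A" if "A \<in> F" for A using that F X by (meson PowD finite_subset subsetD)
  have w0: "w A \<ge> 0" for A by (simp add: w_def)
  show ?thesis
  proof (cases "n = 0")
    case True
    then have "X = {}" using X by (simp add: n_def)
    then have "F = {}" using F by auto
    then show ?thesis by simp
  next
    case False
    then have n: "n > 0" by simp
    define D where "D = (\<Sum>A\<in>F. \<Sum>A'\<in>{A'\<in>F. A' \<subset> A}. w A * w2 A' A)"
    define c where "c = 2 / real n"
    have eqF: "{A\<in>F. A \<subseteq> X} = F" using F by auto
    have chain: "(\<Sum>A\<in>F. w A) - D \<le> 1"
      using chain_inequality[OF X, of F]
      by (simp add: eqF D_def w_def w2_def n_def right_diff_distrib sum_subtractf sum_distrib_left)
    \<comment> \<open>Each comparable pair is charged to whichever of its two members makes the conditional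
      probability of the other one at most \<open>2 / n\<close>.\<close>
    have pair: "w A * w2 A' A \<le> c * (if 2 * card A' \<le> n then w A' else 0) + c * (if 2 * card A' \<le> n then 0 else w A)"
      if A: "A \<in> F" "A' \<in> F" "A' \<subset> A" for A A'
    proof -
      have l1: "card A' < card A" using A fin by (simp add: psubset_card_mono)
      have "A \<subset> X" using A F by auto
      \<comment> \<open>This is where \<open>X \<notin> F\<close> enters: \<open>le_binomial\<close>
        below needs \<open>A\<close> strictly between \<open>A'\<close> and the top.\<close>
      then have l2: "card A < n" using X by (simp add: n_def psubset_card_mono)
      show ?thesis
      proof (cases "2 * card A' \<le> n")
        case True
        \<comment> \<open>Reverses the conditioning: meeting \<open>A\<close> and then
          \<open>A'\<close> below it is the same event as meeting \<open>A'\<close> and then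
          \<open>A\<close> above it.\<close>
        have "(n choose card A) * (card A choose card A') = (n choose card A') * ((n - card A') choose (card A - card A'))"
          using l1 l2 by (intro choose_mult) auto
        then have "w A * w2 A' A = w A' * (1 / real ((n - card A') choose (card A - card A')))"
          by (simp add: w_def w2_def flip: of_nat_mult)
        also have "\<dots> \<le> w A' * c"
        proof (intro mult_left_mono w0)
          have "n - card A' \<le> (n - card A') choose (card A - card A')"
            using l1 l2 by (intro le_binomial) auto
          then have "real n \<le> 2 * real ((n - card A') choose (card A - card A'))" using True by linarith
          then show "1 / real ((n - card A') choose (card A - card A')) \<le> c"
            using n l1 l2 by (simp add: c_def field_simps)
        qed
        finally show ?thesis using True by (simp add: mult.commute)
      next
        case False
        have "card A \<le> card A choose card A'" using False l1 by (intro le_binomial) auto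
        then have "real n \<le> 2 * real (card A choose card A')" using False l1 by linarith
        then have "w2 A' A \<le> c" using n l1 by (simp add: c_def w2_def field_simps)
        then show ?thesis using False mult_left_mono[OF _ w0[of A], of "w2 A' A" c] by (simp add: mult.commute)
      qed
    qed
    have "D \<le> (\<Sum>A\<in>F. \<Sum>A'\<in>{A'\<in>F. A' \<subset> A}.
        c * (if 2 * card A' \<le> n then w A' else 0) + c * (if 2 * card A' \<le> n then 0 else w A))"
      unfolding D_def by (intro sum_mono pair) auto
    also have "\<dots> = c * (\<Sum>A\<in>F. \<Sum>A'\<in>{A'\<in>F. A' \<subset> A}. if 2 * card A' \<le> n then w A' else 0)
        + c * (\<Sum>A\<in>F. \<Sum>A'\<in>{A'\<in>F. A' \<subset> A}. if 2 * card A' \<le> n then 0 else w A)"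
      (is "_ = c * ?U + c * ?L")
      by (simp add: sum.distrib sum_distrib_left)
    finally have split: "D \<le> c * ?U + c * ?L" .
    have "?U = (\<Sum>A'\<in>F. \<Sum>A\<in>{A\<in>F. A' \<subset> A}. if 2 * card A' \<le> n then w A' else 0)"
      by (rule sum.swap_restrict[OF finF finF])
    also have "\<dots> \<le> (\<Sum>v\<in>F. w v * real (card {A\<in>F. v \<subset> A}))"
      by (intro sum_mono) (simp add: w0 mult.commute)
    finally have U: "c * ?U \<le> c * (\<Sum>v\<in>F. w v * real (card {A\<in>F. v \<subset> A}))"
      by (intro mult_left_mono) (simp_all add: c_def)
    have "?L \<le> (\<Sum>A\<in>F. \<Sum>A'\<in>{A'\<in>F. A' \<subset> A}. w A)"
      by (intro sum_mono) (simp add: w0)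
    also have "\<dots> = (\<Sum>v\<in>F. w v * real (card {A\<in>F. A \<subset> v}))"
      by (simp add: mult.commute)
    finally have L: "c * ?L \<le> c * (\<Sum>v\<in>F. w v * real (card {A\<in>F. A \<subset> v}))"
      by (intro mult_left_mono) (simp_all add: c_def)
    have "D \<le> c * (\<Sum>v\<in>F. w v * real (card {A\<in>F. v \<subset> A}))
        + c * (\<Sum>v\<in>F. w v * real (card {A\<in>F. A \<subset> v}))"
      using split U L by linarith
    also have "\<dots> = c * (\<Sum>v\<in>F. w v * real (card {A\<in>F. v \<subset> A} + card {A\<in>F. A \<subset> v}))"
      by (simp only: sum.distrib distrib_left of_nat_add)
    also have "\<dots> \<le> c * (\<Sum>v\<in>F. w v * real d)"
    proof (intro mult_left_mono sum_mono w0)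
      fix v assume v: "v \<in> F"
      have "card {A\<in>F. v \<subset> A} + card {A\<in>F. A \<subset> v} = card ({A\<in>F. v \<subset> A} \<union> {A\<in>F. A \<subset> v})"
        using finF by (subst card_Un_disjoint) auto
      also have "{A\<in>F. v \<subset> A} \<union> {A\<in>F. A \<subset> v} = {u\<in>F. u \<subset> v \<or> v \<subset> u}" by auto
      finally show "real (card {A\<in>F. v \<subset> A} + card {A\<in>F. A \<subset> v}) \<le> real d"
        using deg[OF v] by simp
    qed (simp add: c_def)
    also have "\<dots> = c * real d * (\<Sum>v\<in>F. w v)" by (simp add: sum_distrib_left mult_ac)
    also have "\<dots> \<le> (1 / 2) * (\<Sum>v\<in>F. w v)"
      using d n by (intro mult_right_mono sum_nonneg w0) (simp add: c_def n_def field_simps)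
    finally have "(\<Sum>v\<in>F. w v) \<le> 2" using chain by linarith
    moreover have "(\<Sum>v\<in>F. 1 / real (n choose (n div 2))) \<le> (\<Sum>v\<in>F. w v)"
    proof (intro sum_mono)
      fix v assume "v \<in> F"
      then have "card v \<le> n" using F X by (auto simp: n_def card_mono)
      then show "1 / real (n choose (n div 2)) \<le> w v"
        unfolding w_def using binomial_maximum[of n "card v"] by (intro divide_left_mono) auto
    qed
    ultimately have "real (card F) * (1 / real (n choose (n div 2))) \<le> 2" by simp
    then have "real (card F) \<le> 2 * real (n choose (n div 2))"
      by (simp add: field_simps)
    then show ?thesis unfolding n_def by linarith
  qed
qed

section \<open>The hard-core partition function\<close>

lemma inj_on_insert: "inj_on (insert a) {I. a \<notin> I}"
  by (simp add: inj_on_def insert_ident)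

lemma sum_power_card_Pow:
  fixes x :: real
  assumes "finite S"
  shows "(\<Sum>I\<in>Pow S. x ^ card I) = (1 + x) ^ card S"
  using assms
proof (induction S rule: finite_induct)
  case (insert a S)
  have "(\<Sum>I\<in>Pow (insert a S). x ^ card I) = (\<Sum>I\<in>Pow S. x ^ card I) + (\<Sum>I\<in>insert a ` Pow S. x ^ card I)"
    unfolding Pow_insert using insert by (intro sum.union_disjoint) auto
  also have "(\<Sum>I\<in>insert a ` Pow S. x ^ card I) = (\<Sum>I\<in>Pow S. x ^ card (insert a I))"
    using insert by (subst sum.reindex) (auto intro!: inj_on_subset[OF inj_on_insert])
  also have "\<dots> = x * (\<Sum>I\<in>Pow S. x ^ card I)"
    unfolding sum_distrib_left using insert
    by (intro sum.cong refl) (auto simp: card_insert_if finite_subset)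
  finally show ?case using insert by (simp add: algebra_simps)
qed simp

text \<open>Independent sets of the graph with adjacency \<open>R\<close>; for
  \<open>R = comparable\<close> these are the antichains.\<close>

definition indep :: "('a \<Rightarrow> 'a \<Rightarrow> bool) \<Rightarrow> 'a set \<Rightarrow> bool" where
  "indep R I \<longleftrightarrow> (\<forall>u\<in>I. \<forall>v\<in>I. \<not> R u v)"

text \<open>Branch on a vertex with at least \<open>d\<close> neighbours: an independent set either
  avoids it or avoids all its neighbours. The condition on \<open>\<beta>\<close> says that growth
  by \<open>\<beta>\<close> per vertex survives this recursion. Once at most \<open>K\<close>
  vertices remain, all their subsets are counted.\<close>

lemma hard_core_sum_le:
  fixes x \<beta> :: real
  assumes fin: "finite V" and x: "x \<ge> 0" and \<beta>: "\<beta> \<ge> 1" "x \<le> \<beta> ^ d * (\<beta> - 1)"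
    and irr: "\<And>v. v \<in> V \<Longrightarrow> \<not> R v v"
    and deg: "\<And>S. S \<subseteq> V \<Longrightarrow> K < card S \<Longrightarrow> \<exists>v\<in>S. d \<le> card {u\<in>S. R v u}"
    and S: "S \<subseteq> V"
  shows "(\<Sum>I\<in>{I. I \<subseteq> S \<and> indep R I}. x ^ card I) \<le> (1 + x) ^ K * \<beta> ^ card S"
  using finite_subset[OF S fin] S
proof (induction S rule: finite_psubset_induct)
  case (psubset S)
  define Z where "Z S = (\<Sum>I\<in>{I. I \<subseteq> S \<and> indep R I}. x ^ card I)" for S
  have fS: "finite S" by fact
  have "Z S \<le> (1 + x) ^ K * \<beta> ^ card S"
  proof (cases "card S \<le> K")
    case True
    have "Z S \<le> (\<Sum>I\<in>Pow S. x ^ card I)"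
      unfolding Z_def using fS x by (intro sum_mono2) auto
    also have "\<dots> = (1 + x) ^ card S * 1" using sum_power_card_Pow[OF fS] by simp
    also have "\<dots> \<le> (1 + x) ^ K * \<beta> ^ card S"
      using True x \<beta> by (intro mult_mono power_increasing) auto
    finally show ?thesis .
  next
    case False
    then obtain v where v: "v \<in> S" "d \<le> card {u\<in>S. R v u}" using deg[of S] psubset.prems by auto
    define N where "N = {u\<in>S. R v u}"
    define S1 where "S1 = S - {v}"
    define S2 where "S2 = S - {v} - N"
    have vN: "v \<notin> N" using irr v psubset.prems by (auto simp: N_def)
    have NS: "N \<subseteq> S1" using vN by (auto simp: N_def S1_def)
    have c1: "card S = Suc (card S1)" using card_Suc_Diff1[OF fS v(1)] by (simp only: S1_def)
    have c2: "card S2 = card S1 - card N"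
      unfolding S2_def S1_def[symmetric] using NS fS
      by (intro card_Diff_subset finite_subset[OF NS]) (auto simp: S1_def)
    have cN: "card N \<le> card S1" using NS fS by (intro card_mono) (auto simp: S1_def)
    have IH: "Z T \<le> (1 + x) ^ K * \<beta> ^ card T" if "T \<subset> S" for T
      using psubset.IH[OF that] psubset.prems that unfolding Z_def by auto
    \<comment> \<open>Deletion and contraction: \<open>Z S \<le> Z (S - {v}) + x * Z (S - {v} - N)\<close>.\<close>
    have "{I. I \<subseteq> S \<and> indep R I} \<subseteq> {I. I \<subseteq> S1 \<and> indep R I} \<union> insert v ` {I. I \<subseteq> S2 \<and> indep R I}"
    proof safe
      fix I assume I: "I \<subseteq> S" "indep R I" "I \<notin> insert v ` {I. I \<subseteq> S2 \<and> indep R I}"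
      {
        assume "v \<in> I"
        then have "I = insert v (I - {v})" "I - {v} \<subseteq> S2" "indep R (I - {v})"
          using I(1,2) by (auto simp: S2_def N_def indep_def)
        then have False using I(3) by blast
      }
      then show "x \<in> S1" if "x \<in> I" for x using that I(1) by (auto simp: S1_def)
    qed
    then have "Z S \<le> (\<Sum>I\<in>{I. I \<subseteq> S1 \<and> indep R I} \<union> insert v ` {I. I \<subseteq> S2 \<and> indep R I}. x ^ card I)"
      unfolding Z_def using fS x by (intro sum_mono2) (auto simp: S1_def S2_def)
    also have "\<dots> \<le> Z S1 + (\<Sum>I\<in>insert v ` {I. I \<subseteq> S2 \<and> indep R I}. x ^ card I)"
      unfolding Z_def using fS x by (subst sum.union_disjoint) (auto simp: S1_def S2_def)
    also have "(\<Sum>I\<in>insert v ` {I. I \<subseteq> S2 \<and> indep R I}. x ^ card I)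
        = (\<Sum>I\<in>{I. I \<subseteq> S2 \<and> indep R I}. x ^ card (insert v I))"
      by (subst sum.reindex) (auto intro!: inj_on_subset[OF inj_on_insert] simp: S2_def)
    also have "\<dots> = x * Z S2"
      unfolding Z_def sum_distrib_left
    proof (intro sum.cong refl)
      fix I assume "I \<in> {I. I \<subseteq> S2 \<and> indep R I}"
      then have "v \<notin> I" "finite I" using fS by (auto simp: S2_def intro: finite_subset)
      then show "x ^ card (insert v I) = x * x ^ card I" by simp
    qed
    also have "Z S1 \<le> (1 + x) ^ K * \<beta> ^ card S1"
      using v by (intro IH) (auto simp: S1_def)
    also have "x * Z S2 \<le> (\<beta> ^ d * (\<beta> - 1)) * ((1 + x) ^ K * \<beta> ^ card S2)"
      using v x \<beta> by (intro mult_mono IH) (auto simp: S2_def Z_def intro!: sum_nonneg)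
    also have "\<dots> = (\<beta> - 1) * (1 + x) ^ K * \<beta> ^ (d + card S2)"
      by (simp add: power_add)
    \<comment> \<open>Contraction loses at least \<open>d\<close> vertices besides \<open>v\<close>,
      so \<open>d + card S2 \<le> card S1\<close>.\<close>
    also have "\<dots> \<le> (\<beta> - 1) * (1 + x) ^ K * \<beta> ^ card S1"
      using v c2 cN \<beta> x by (intro mult_left_mono power_increasing) (auto simp: N_def)
    finally show ?thesis by (simp add: c1 algebra_simps)
  qed
  then show ?case by (simp add: Z_def)
qed

section \<open>Central binomial coefficients\<close>

lemma central_binomial_Suc:
  "real (Suc m) * real ((2 * Suc m) choose Suc m) = 2 * (2 * real m + 1) * real ((2 * m) choose m)"
proof -
  have "Suc m * (Suc (2 * m + 1) choose Suc m) = Suc (2 * m + 1) * ((2 * m + 1) choose m)"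
    by (metis Suc_times_binomial_eq mult.commute)
  then have "Suc m * ((2 * Suc m) choose Suc m) = Suc m * (2 * ((2 * m + 1) choose m))"
    by (simp add: algebra_simps)
  then have 1: "(2 * Suc m) choose Suc m = 2 * ((2 * m + 1) choose m)"
    by (simp only: mult_cancel1) simp
  have "(2 * m + 1 - m) * ((2 * m + 1) choose m) = (2 * m + 1) * ((2 * m + 1 - 1) choose m)"
    by (rule binomial_absorb_comp)
  then have "Suc m * ((2 * m + 1) choose m) = (2 * m + 1) * ((2 * m) choose m)"
    by simp
  then have "Suc m * ((2 * Suc m) choose Suc m) = 2 * (2 * m + 1) * ((2 * m) choose m)"
    unfolding 1 by (simp only: mult.assoc mult.left_commute)
  then have "real (Suc m * ((2 * Suc m) choose Suc m)) = real (2 * (2 * m + 1) * ((2 * m) choose m))"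
    by (simp only:)
  then show ?thesis by (simp only: of_nat_mult of_nat_add of_nat_numeral of_nat_1)
qed

text \<open>The induction step rests on
  \<open>(2 * m + 1) * (2 * m + 3) \<le> 4 * (m + 1) ^ 2\<close>.\<close>

lemma central_binomial_upper: "real ((2 * m) choose m) ^ 2 * (2 * real m + 1) \<le> 16 ^ m"
proof (induction m)
  case (Suc m)
  define c where "c = real ((2 * m) choose m)"
  define c' where "c' = real ((2 * Suc m) choose Suc m)"
  have "real (Suc m) * c' = 2 * (2 * real m + 1) * c"
    unfolding c_def c'_def by (rule central_binomial_Suc)
  then have "real (Suc m) ^ 2 * c' ^ 2 = (2 * (2 * real m + 1) * c) ^ 2"
    by (simp only: flip: power_mult_distrib)
  then have "real (Suc m) ^ 2 * (c' ^ 2 * (2 * real m + 3)) = (2 * (2 * real m + 1) * c) ^ 2 * (2 * real m + 3)"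
    by (simp only: flip: mult.assoc)
  also have "\<dots> = (c ^ 2 * (2 * real m + 1)) * (4 * (2 * real m + 1) * (2 * real m + 3))"
    by (simp add: power2_eq_square algebra_simps)
  also have "\<dots> \<le> 16 ^ m * (16 * real (Suc m) ^ 2)"
  proof (rule mult_mono)
    show "c ^ 2 * (2 * real m + 1) \<le> 16 ^ m" using Suc.IH by (simp add: c_def)
  qed (auto simp: power2_eq_square algebra_simps)
  finally have "real (Suc m) ^ 2 * (c' ^ 2 * (2 * real m + 3)) \<le> real (Suc m) ^ 2 * 16 ^ Suc m"
    by (simp only: power_Suc mult_ac)
  then have "c' ^ 2 * (2 * real m + 3) \<le> 16 ^ Suc m"
    by (rule mult_left_le_imp_le) simp
  then show ?case by (simp add: c'_def algebra_simps)
qed simp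

text \<open>Equality holds at \<open>m = 1\<close>, where the induction effectively starts; the step
  rests on \<open>4 * m * (m + 1) \<le> (2 * m + 1) ^ 2\<close>.\<close>

lemma central_binomial_lower: "m > 0 \<Longrightarrow> 16 ^ m \<le> real ((2 * m) choose m) ^ 2 * (4 * real m)"
proof (induction m)
  case (Suc m)
  show ?case
  proof (cases "m = 0")
    case False
    define c where "c = real ((2 * m) choose m)"
    define c' where "c' = real ((2 * Suc m) choose Suc m)"
    have "real (Suc m) * c' = 2 * (2 * real m + 1) * c"
      unfolding c_def c'_def by (rule central_binomial_Suc)
    then have sq: "real (Suc m) ^ 2 * c' ^ 2 = (2 * (2 * real m + 1) * c) ^ 2"
      by (simp only: flip: power_mult_distrib)
    have "real (Suc m) * real m * 16 ^ Suc m \<le> (16 * real (Suc m) * real m) * (c ^ 2 * (4 * real m))"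
      (is "?l \<le> _")
    proof -
      have "?l = (16 * real (Suc m) * real m) * 16 ^ m" by (simp only: power_Suc mult_ac)
      also have "\<dots> \<le> (16 * real (Suc m) * real m) * (c ^ 2 * (4 * real m))"
        using Suc.IH False unfolding c_def by (intro mult_left_mono) auto
      finally show ?thesis .
    qed
    also have "\<dots> = (4 * real m) * (c ^ 2 * (16 * real (Suc m) * real m))"
      by (simp only: mult_ac)
    also have "\<dots> \<le> (4 * real m) * (c ^ 2 * (4 * (2 * real m + 1) ^ 2))"
      by (intro mult_left_mono) (auto simp: power2_eq_square algebra_simps)
    also have "\<dots> = (4 * real m) * (2 * (2 * real m + 1) * c) ^ 2"
      by (simp add: power2_eq_square algebra_simps)
    also have "\<dots> = real (Suc m) * real m * (c' ^ 2 * (4 * real (Suc m)))"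
      unfolding sq[symmetric] by (simp only: power2_eq_square mult_ac)
    finally have "16 ^ Suc m \<le> c' ^ 2 * (4 * real (Suc m))"
      by (rule mult_left_le_imp_le) (use False in simp)
    then show ?thesis by (simp add: c'_def)
  qed simp
qed simp

text \<open>Anticoncentration: the number of heads in \<open>n\<close> fair coin flips takes no
  value with probability above \<open>1 / sqrt n\<close>.\<close>

lemma binomial_mult_sqrt_le: "real (n choose k) * sqrt (real n) \<le> 2 ^ n"
proof -
  \<comment> \<open>The root has \<open>2 * m + 1\<close> rather than \<open>2 * m\<close> so that
    the odd row \<open>n = 2 * m + 1\<close> follows by Pascal's rule.\<close>
  have even: "real ((2 * m) choose m) * sqrt (2 * real m + 1) \<le> 4 ^ m" for m
  proof (rule power2_le_imp_le)
    have "(16::real) ^ m = (4 ^ m) ^ 2" by (simp flip: power_mult power_mult_distrib add: power2_eq_square)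
    then show "(real ((2 * m) choose m) * sqrt (2 * real m + 1)) ^ 2 \<le> (4 ^ m) ^ 2"
      using central_binomial_upper[of m] by (simp add: power_mult_distrib)
  qed simp
  show ?thesis
  proof (cases "even n")
    case True
    then obtain m where m: "n = 2 * m" by (elim evenE)
    have "real (n choose k) * sqrt (real n) \<le> real ((2 * m) choose m) * sqrt (2 * real m + 1)"
      unfolding m using binomial_maximum'[of m k] by (intro mult_mono) auto
    also have "\<dots> \<le> 2 ^ n" using even[of m] by (simp add: m power_mult)
    finally show ?thesis .
  next
    case False
    then obtain m where m: "n = Suc (2 * m)" by (auto elim: oddE)
    have "(n choose k) \<le> 2 * ((2 * m) choose m)"
    proof (cases k)
      case 0
      have "0 < (2 * m) choose m" by simp
      then have "1 \<le> 2 * ((2 * m) choose m)" by linarith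
      then show ?thesis using 0 by simp
    next
      case (Suc j)
      then show ?thesis unfolding m using binomial_maximum'[of m j] binomial_maximum'[of m k] by simp
    qed
    then have "real (n choose k) \<le> 2 * real ((2 * m) choose m)" by linarith
    then have "real (n choose k) * sqrt (real n) \<le> 2 * real ((2 * m) choose m) * sqrt (2 * real m + 1)"
      by (intro mult_mono) (auto simp: m)
    also have "\<dots> \<le> 2 ^ n" using even[of m] by (simp add: m power_mult)
    finally show ?thesis .
  qed
qed

text \<open>Serves twice: to measure the size of the cube in units of the middle level, and to turn
  \<open>1 / sqrt N\<close> into the final bound.\<close>

lemma power_four_le_sqrt_mult_central_binomial:
  assumes "m > 0"
  shows "4 ^ m \<le> 2 * sqrt (real m) * real ((2 * m) choose m)"
proof (rule power2_le_imp_le)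
  have "((4::real) ^ m) ^ 2 = 16 ^ m" by (simp flip: power_mult_distrib power_mult add: power2_eq_square)
  also have "\<dots> \<le> real ((2 * m) choose m) ^ 2 * (4 * real m)" using assms by (rule central_binomial_lower)
  also have "\<dots> = (2 * sqrt (real m) * real ((2 * m) choose m)) ^ 2"
    by (simp add: power_mult_distrib)
  finally show "(4 ^ m)\<^sup>2 \<le> (2 * sqrt (real m) * real ((2 * m) choose m)) ^ 2" .
qed simp

section \<open>Complexes with prescribed faces of one parity\<close>

definition maximal_faces :: "'a set set \<Rightarrow> 'a set set" where
  "maximal_faces \<Delta> = {x\<in>\<Delta>. \<forall>y\<in>\<Delta>. \<not> x \<subset> y}"

text \<open>\<open>True\<close> selects the odd sets, whose sign in the Euler characteristic is +1.
  The empty set and, since their \<open>card\<close> is 0 by default, all infinite sets lie in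
  \<open>parity_class False\<close>.\<close>

definition parity_class :: "bool \<Rightarrow> nat set set" where
  "parity_class b = {x. odd (card x) = b}"

text \<open>For \<open>P\<close> a parity class and \<open>E\<close> the set of faces of \<open>\<Delta>\<close> outside \<open>P\<close>: the sets in \<open>P\<close> that
  \<open>E\<close> forces into \<open>\<Delta>\<close>, and those whose membership \<open>E\<close> leaves open.\<close>

definition forced_faces :: "nat set set \<Rightarrow> nat set set \<Rightarrow> nat set set" where
  "forced_faces P E = {x\<in>P. x \<noteq> {} \<and> (\<exists>y\<in>E. x \<subset> y)}"

definition free_faces :: "nat \<Rightarrow> nat set set \<Rightarrow> nat set set \<Rightarrow> nat set set" where
  "free_faces n P E = {x\<in>P. x \<noteq> {} \<and> x \<subseteq> {1..n} \<and>
     (\<forall>y. y \<noteq> {} \<and> y \<subset> x \<and> y \<notin> P \<longrightarrow> y \<in> E) \<and> (\<forall>y\<in>E. \<not> x \<subset> y)}"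

text \<open>Adding one element flips the parity. Hence any constraint between two sets of one class
  is already visible in the other class.\<close>

lemma parity_class_between:
  assumes "y \<in> parity_class b" "z \<in> parity_class b" "y \<subset> z" "finite z"
  obtains u where "u \<notin> parity_class b" "y \<subset> u" "u \<subset> z"
proof -
  obtain a where a: "a \<in> z" "a \<notin> y" using assms by blast
  have fy: "finite y" using assms by (meson finite_subset psubset_imp_subset)
  have u: "insert a y \<notin> parity_class b" using assms a fy by (simp add: parity_class_def)
  then have "insert a y \<noteq> z" using assms by blast
  then show thesis using that[OF u] a assms by blast
qed

lemma simplicial_complexes_iff:
  "\<Delta> \<in> simplicial_complexes n \<longleftrightarrow>
    (\<forall>x\<in>\<Delta>. x \<noteq> {} \<and> x \<subseteq> {1..n}) \<and> (\<forall>x\<in>\<Delta>. \<forall>y. y \<noteq> {} \<and> y \<subseteq> x \<longrightarrow> y \<in> \<Delta>)"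
  unfolding simplicial_complexes_def by (rule mem_Collect_eq)

lemma simplicial_complexesD:
  assumes "\<Delta> \<in> simplicial_complexes n"
  shows "x \<in> \<Delta> \<Longrightarrow> x \<noteq> {}" "x \<in> \<Delta> \<Longrightarrow> x \<subseteq> {1..n}"
    "x \<in> \<Delta> \<Longrightarrow> y \<noteq> {} \<Longrightarrow> y \<subseteq> x \<Longrightarrow> y \<in> \<Delta>"
proof -
  note * = assms[unfolded simplicial_complexes_iff]
  show "x \<in> \<Delta> \<Longrightarrow> x \<noteq> {}" "x \<in> \<Delta> \<Longrightarrow> x \<subseteq> {1..n}" using conjunct1[OF *] by simp_all
  show "x \<in> \<Delta> \<Longrightarrow> y \<noteq> {} \<Longrightarrow> y \<subseteq> x \<Longrightarrow> y \<in> \<Delta>" using conjunct2[OF *] by metis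
qed

lemma simplicial_complexesI:
  assumes "\<And>x. x \<in> \<Delta> \<Longrightarrow> x \<noteq> {}" "\<And>x. x \<in> \<Delta> \<Longrightarrow> x \<subseteq> {1..n}"
    "\<And>x y. x \<in> \<Delta> \<Longrightarrow> y \<noteq> {} \<Longrightarrow> y \<subseteq> x \<Longrightarrow> y \<in> \<Delta>"
  shows "\<Delta> \<in> simplicial_complexes n"
  unfolding simplicial_complexes_iff
  by (intro conjI ballI allI impI; (elim conjE)?; rule assms; assumption)

lemma finite_simplicial_complex: "\<Delta> \<in> simplicial_complexes n \<Longrightarrow> finite \<Delta>"
  by (rule finite_subset[of _ "Pow {1..n}"]) (use simplicial_complexesD(2) in blast, simp)

text \<open>Once the faces outside \<open>P\<close> are fixed, each set in \<open>P\<close> is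
  forced in, forced out or free, and the free ones can be chosen independently. The complex
  \<open>\<Delta>\<^sub>0\<close> guarantees that \<open>E\<close> does arise from a
  complex.\<close>

lemma parity_fibre_eq:
  fixes n b E
  defines "P \<equiv> parity_class b"
  assumes \<Delta>0: "\<Delta>\<^sub>0 \<in> simplicial_complexes n" "\<Delta>\<^sub>0 - P = E"
  shows "{\<Delta>\<in>simplicial_complexes n. \<Delta> - P = E}
    = (\<lambda>G. E \<union> forced_faces P E \<union> G) ` Pow (free_faces n P E)" (is "?A = ?f ` _")
proof (intro equalityI subsetI)
  fix \<Delta> assume "\<Delta> \<in> ?A"
  then have \<Delta>: "\<Delta> \<in> simplicial_complexes n" "\<Delta> - P = E" by auto
  note D = simplicial_complexesD[OF \<Delta>(1)]
  have "x \<in> ?f (\<Delta> \<inter> free_faces n P E)" if x: "x \<in> \<Delta>" for x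
  proof (cases "x \<in> P \<and> x \<notin> forced_faces P E")
    case True
    then have "x \<in> free_faces n P E"
      using \<Delta>(2) x D(1,2)[OF x] D(3)[OF x] unfolding forced_faces_def free_faces_def by blast
    then show ?thesis using x by blast
  qed (use x \<Delta>(2) in blast)
  moreover have "forced_faces P E \<subseteq> \<Delta>"
    using D(3) \<Delta>(2) unfolding forced_faces_def by blast
  ultimately have "\<Delta> = ?f (\<Delta> \<inter> free_faces n P E)" using \<Delta>(2) by blast
  then show "\<Delta> \<in> ?f ` Pow (free_faces n P E)" by blast
next
  fix \<Delta> assume "\<Delta> \<in> ?f ` Pow (free_faces n P E)"
  then obtain G where G: "G \<subseteq> free_faces n P E" "\<Delta> = ?f G" by blast
  note D = simplicial_complexesD[OF \<Delta>0(1)]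
  have sub: "x \<noteq> {}" "x \<subseteq> {1..n}" if "x \<in> \<Delta>" for x
  proof -
    have "x \<in> E \<Longrightarrow> x \<noteq> {} \<and> x \<subseteq> {1..n}" using D \<Delta>0(2) by blast
    moreover have "x \<in> forced_faces P E \<Longrightarrow> x \<noteq> {} \<and> x \<subseteq> {1..n}"
      using D(2) \<Delta>0(2) unfolding forced_faces_def by blast
    moreover have "x \<in> G \<Longrightarrow> x \<noteq> {} \<and> x \<subseteq> {1..n}" using G by (auto simp: free_faces_def)
    ultimately show "x \<noteq> {}" "x \<subseteq> {1..n}" using that G(2) by auto
  qed
  have below: "y \<in> E \<union> forced_faces P E" if "z \<in> E" "y \<noteq> {}" "y \<subseteq> z" for y z
  proof (cases "y \<in> P")
    case True
    then have "y \<noteq> z" using that \<Delta>0(2) by blast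
    then show ?thesis using that True by (auto simp: forced_faces_def)
  next
    case False
    then show ?thesis using that \<Delta>0(2) D by blast
  qed
  have down: "y \<in> \<Delta>" if z: "z \<in> \<Delta>" and y: "y \<noteq> {}" "y \<subseteq> z" for y z
  proof -
    consider "z \<in> E" | "z \<in> forced_faces P E" | "z \<in> G" "y = z" | "z \<in> G" "y \<subset> z" "y \<notin> P"
      | "z \<in> G" "y \<subset> z" "y \<in> P"
      using z y G(2) by blast
    then show ?thesis
    proof cases
      case 1
      then show ?thesis using below y G(2) by blast
    next
      case 2
      then obtain w where "w \<in> E" "z \<subset> w" by (auto simp: forced_faces_def)
      then show ?thesis using below[of w y] y G(2) by blast
    next
      case 3
      then show ?thesis using z by simp
    next
      case 4
      then have "y \<in> E" using G y by (auto simp: free_faces_def)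
      then show ?thesis using G by simp
    next
      \<comment> \<open>Two sets of \<open>P\<close> cannot constrain each other: the set
        \<open>u\<close> between them lies in \<open>E\<close> and forces \<open>y\<close>, whatever
        \<open>G\<close> is.\<close>
      case 5
      have zP: "z \<in> P" using 5 G by (auto simp: free_faces_def)
      have "finite z" using sub(2)[OF z] by (rule finite_subset) simp
      then obtain u where u: "u \<notin> P" "y \<subset> u" "u \<subset> z"
        using parity_class_between 5 zP unfolding P_def by metis
      then have "u \<in> E" using G 5 y by (auto simp: free_faces_def)
      then have "y \<in> forced_faces P E" using 5 u y by (auto simp: forced_faces_def)
      then show ?thesis using G by simp
    qed
  qed
  have "\<Delta> - P = E" using G \<Delta>0(2) by (auto simp: forced_faces_def free_faces_def)
  moreover have "\<Delta> \<in> simplicial_complexes n"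
    using sub down by (rule simplicial_complexesI)
  ultimately show "\<Delta> \<in> ?A" by simp
qed

text \<open>A maximal face has all its non-empty proper subsets in the complex and no face above it,
  so nothing in \<open>E\<close> forces it in or out. Maximal faces thus bound the number of coin
  flips from below.\<close>

lemma maximal_faces_subset_free_faces:
  assumes "\<Delta> \<in> simplicial_complexes n" "\<Delta> - P = E"
  shows "maximal_faces \<Delta> \<inter> P \<subseteq> free_faces n P E"
proof
  fix x assume x: "x \<in> maximal_faces \<Delta> \<inter> P"
  then have "x \<in> \<Delta>" by (simp add: maximal_faces_def)
  note D = simplicial_complexesD[OF assms(1) this]
  show "x \<in> free_faces n P E"
    using x D assms(2) unfolding maximal_faces_def free_faces_def by blast
qed

text \<open>Faces of one parity share their sign. The empty set is excluded because the truncated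
  exponent would give it +1 despite its even size.\<close>

lemma euler_char_union_parity:
  assumes "finite A" "finite G" "A \<inter> G = {}" "{} \<notin> G" "G \<subseteq> parity_class b" "\<And>x. x \<in> G \<Longrightarrow> finite x"
  shows "euler_char (A \<union> G) = euler_char A + (if b then 1 else -1) * int (card G)"
proof -
  have "(\<Sum>x\<in>G. (-1) ^ (card x - 1)) = (\<Sum>x\<in>G. if b then 1 else -1 :: int)"
  proof (intro sum.cong refl)
    fix x assume x: "x \<in> G"
    then have "card x > 0" using assms by (auto simp: card_gt_0_iff)
    moreover have "odd (card x) = b" using x assms by (auto simp: parity_class_def)
    ultimately show "(-1) ^ (card x - 1) = (if b then 1 else -1 :: int)" by auto
  qed
  then show ?thesis using assms by (simp add: euler_char_def sum.union_disjoint)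
qed

text \<open>Within a fibre the Euler characteristic determines how many free faces are chosen, so
  the fibre has \<open>2 ^ card F\<close> members of which a single binomial coefficient bounds
  those with value \<open>k\<close>.\<close>

lemma card_fibre_euler_char_le:
  fixes n b E t k
  defines "P \<equiv> parity_class b"
  shows "real (card {\<Delta>\<in>simplicial_complexes n. \<Delta> - P = E \<and> euler_char \<Delta> = k \<and> t \<le> card (maximal_faces \<Delta> \<inter> P)})
     * sqrt (real t) \<le> real (card {\<Delta>\<in>simplicial_complexes n. \<Delta> - P = E})"
    (is "real (card ?B) * _ \<le> real (card ?A)")
proof (cases "?B = {}")
  case False
  then obtain \<Delta>0 where \<Delta>0: "\<Delta>0 \<in> ?B" by blast
  define F where "F = free_faces n P E"
  define H where "H = E \<union> forced_faces P E"
  have A: "?A = (\<lambda>G. H \<union> G) ` Pow F"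
    unfolding H_def F_def P_def by (rule parity_fibre_eq) (use \<Delta>0 in \<open>auto simp: P_def\<close>)
  have finF: "finite F" by (rule finite_subset[of _ "Pow {1..n}"]) (auto simp: F_def free_faces_def)
  have HF: "H \<inter> F = {}" using \<Delta>0 by (auto simp: H_def F_def forced_faces_def free_faces_def)
  have inj: "inj_on (\<lambda>G. H \<union> G) (Pow F)"
    using HF by (intro inj_on_inverseI[where g = "\<lambda>X. X \<inter> F"]) blast
  have "H \<union> {} \<in> ?A" unfolding A by blast
  then have "H \<in> simplicial_complexes n" by simp
  then have finH: "finite H" by (rule finite_simplicial_complex)
  have cardA: "card ?A = 2 ^ card F" unfolding A using inj finF by (simp add: card_image card_Pow)
  have euler: "euler_char (H \<union> G) = euler_char H + (if b then 1 else -1) * int (card G)" if "G \<subseteq> F" for G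
  proof (rule euler_char_union_parity)
    show "finite G" using that finF by (rule finite_subset)
    show "{} \<notin> G" "G \<subseteq> parity_class b" using that by (auto simp: F_def free_faces_def P_def)
    show "finite x" if "x \<in> G" for x
      by (rule finite_subset[of _ "{1..n}"]) (use that \<open>G \<subseteq> F\<close> in \<open>auto simp: F_def free_faces_def\<close>)
  qed (use finH HF that in auto)
  obtain G0 where G0: "G0 \<subseteq> F" "\<Delta>0 = H \<union> G0" using A \<Delta>0 by blast
  have "?B \<subseteq> (\<lambda>G. H \<union> G) ` {G. G \<subseteq> F \<and> card G = card G0}"
  proof
    fix \<Delta> assume \<Delta>: "\<Delta> \<in> ?B"
    then obtain G where G: "G \<subseteq> F" "\<Delta> = H \<union> G" using A by blast
    have "euler_char (H \<union> G) = euler_char (H \<union> G0)" using \<Delta> \<Delta>0 G G0 by simp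
    then have "card G = card G0" using euler[OF G(1)] euler[OF G0(1)] by (simp split: if_splits)
    then show "\<Delta> \<in> (\<lambda>G. H \<union> G) ` {G. G \<subseteq> F \<and> card G = card G0}" using G by blast
  qed
  then have "card ?B \<le> card {G. G \<subseteq> F \<and> card G = card G0}"
    using finF by (intro surj_card_le) auto
  also have "\<dots> = card F choose card G0" using finF by (rule n_subsets)
  finally have B: "card ?B \<le> card F choose card G0" .
  \<comment> \<open>The free faces depend on \<open>E\<close> alone, so one complex with
    \<open>t\<close> maximal faces in \<open>P\<close> bounds \<open>card F\<close> for the whole
    fibre.\<close>
  have "t \<le> card (maximal_faces \<Delta>0 \<inter> P)" using \<Delta>0 by simp
  also have "\<dots> \<le> card F"
    unfolding F_def using maximal_faces_subset_free_faces[of \<Delta>0 n P E] \<Delta>0 finF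
    by (intro card_mono) (auto simp: F_def)
  finally have "real (card ?B) * sqrt (real t) \<le> real (card F choose card G0) * sqrt (real (card F))"
    using B by (intro mult_mono) auto
  also have "\<dots> \<le> 2 ^ card F" by (rule binomial_mult_sqrt_le)
  finally show ?thesis by (simp add: cardA)
next
  case True
  then show ?thesis by (simp only: card.empty of_nat_0 mult_zero_left of_nat_0_le_iff)
qed

lemma card_euler_char_le:
  fixes n b t k
  defines "P \<equiv> parity_class b"
  shows "real (card {\<Delta>\<in>simplicial_complexes n. euler_char \<Delta> = k \<and> t \<le> card (maximal_faces \<Delta> \<inter> P)})
     * sqrt (real t) \<le> real (card (simplicial_complexes n))"
    (is "real (card ?B) * _ \<le> _")
proof -
  let ?S = "simplicial_complexes n"
  let ?T = "(\<lambda>\<Delta>. \<Delta> - P) ` ?S"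
  have fin: "finite ?S" by (rule finite_simplicial_complexes)
  have "(\<lambda>\<Delta>. \<Delta> - P) ` ?B \<subseteq> ?T" by blast
  then have B: "card ?B = (\<Sum>E\<in>?T. card {\<Delta>\<in>?B. \<Delta> - P = E})"
    using sum.group[of ?B ?T "\<lambda>\<Delta>. \<Delta> - P" "\<lambda>_. 1::nat"] fin by simp
  have S: "card ?S = (\<Sum>E\<in>?T. card {\<Delta>\<in>?S. \<Delta> - P = E})"
    using sum.group[of ?S ?T "\<lambda>\<Delta>. \<Delta> - P" "\<lambda>_. 1::nat"] fin by simp
  have "real (card ?B) * sqrt (real t) = (\<Sum>E\<in>?T. real (card {\<Delta>\<in>?B. \<Delta> - P = E}) * sqrt (real t))"
    by (subst B) (simp add: sum_distrib_right)
  also have "\<dots> \<le> (\<Sum>E\<in>?T. real (card {\<Delta>\<in>?S. \<Delta> - P = E}))"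
  proof (intro sum_mono)
    fix E
    have "{\<Delta>\<in>?B. \<Delta> - P = E} = {\<Delta>\<in>?S. \<Delta> - P = E \<and> euler_char \<Delta> = k \<and> t \<le> card (maximal_faces \<Delta> \<inter> P)}"
      by auto
    then show "real (card {\<Delta>\<in>?B. \<Delta> - P = E}) * sqrt (real t) \<le> real (card {\<Delta>\<in>?S. \<Delta> - P = E})"
      using card_fibre_euler_char_le[of n b E k t] unfolding P_def by simp
  qed
  also have "\<dots> = real (card ?S)" by (simp add: S)
  finally show ?thesis .
qed

section \<open>Counting complexes with few maximal faces\<close>

text \<open>By finiteness every face lies in a maximal one, so taking all non-empty subsets is a
  left inverse.\<close>

lemma inj_on_maximal_faces: "inj_on maximal_faces (simplicial_complexes n)"
proof (rule inj_on_inverseI[where g = "\<lambda>M. {y. y \<noteq> {} \<and> (\<exists>x\<in>M. y \<subseteq> x)}"])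
  fix \<Delta> assume \<Delta>: "\<Delta> \<in> simplicial_complexes n"
  note D = simplicial_complexesD[OF \<Delta>]
  have "\<exists>x\<in>maximal_faces \<Delta>. y \<subseteq> x" if y: "y \<in> \<Delta>" for y
  proof -
    obtain x where "x \<in> \<Delta>" "y \<subseteq> x" "\<forall>z\<in>\<Delta>. x \<subseteq> z \<longrightarrow> x = z"
      using finite_has_maximal2[OF finite_simplicial_complex[OF \<Delta>] y] by blast
    then show ?thesis unfolding maximal_faces_def by blast
  qed
  moreover have "maximal_faces \<Delta> \<subseteq> \<Delta>" by (auto simp: maximal_faces_def)
  ultimately have "y \<noteq> {} \<and> (\<exists>x\<in>maximal_faces \<Delta>. y \<subseteq> x) \<longleftrightarrow> y \<in> \<Delta>" for y
    using D(1)[of y] D(3)[of _ y] by (meson subsetD)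
  then show "{y. y \<noteq> {} \<and> (\<exists>x\<in>maximal_faces \<Delta>. y \<subseteq> x)} = \<Delta>"
    by simp
qed

abbreviation comparable :: "'a set \<Rightarrow> 'a set \<Rightarrow> bool" where
  "comparable u v \<equiv> u \<subset> v \<or> v \<subset> u"

text \<open>As \<open>x \<le> 1\<close>, each antichain of size at most \<open>s\<close> contributes
  at least \<open>x ^ s\<close> to the partition function.\<close>

lemma card_few_maximal_faces_le:
  fixes x :: real
  assumes "0 < x" "x \<le> 1"
  shows "real (card {\<Delta>\<in>simplicial_complexes n. card (maximal_faces \<Delta>) \<le> s}) * x ^ s
    \<le> (\<Sum>I\<in>{I. I \<subseteq> Pow {1..n} \<and> indep comparable I}. x ^ card I)" (is "real (card ?B) * _ \<le> _")
proof -
  have "real (card ?B) * x ^ s = (\<Sum>\<Delta>\<in>?B. x ^ s)" by simp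
  also have "\<dots> \<le> (\<Sum>\<Delta>\<in>?B. x ^ card (maximal_faces \<Delta>))"
    using assms by (intro sum_mono power_decreasing) auto
  also have "\<dots> = (\<Sum>I\<in>maximal_faces ` ?B. x ^ card I)"
    by (subst sum.reindex) (auto intro: inj_on_subset[OF inj_on_maximal_faces])
  also have "\<dots> \<le> (\<Sum>I\<in>{I. I \<subseteq> Pow {1..n} \<and> indep comparable I}. x ^ card I)"
  proof (rule sum_mono2)
    show "finite {I. I \<subseteq> Pow {1..n} \<and> indep comparable I}" by simp
    show "maximal_faces ` ?B \<subseteq> {I. I \<subseteq> Pow {1..n} \<and> indep comparable I}"
      using simplicial_complexesD(2) unfolding indep_def maximal_faces_def by blast
  qed (use assms in simp)
  finally show ?thesis .
qed

text \<open>Supersaturation supplies the branching vertices with \<open>d = m div 2\<close>, a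
  quarter of the ground set up to rounding. The \<open>+ 1\<close> pays for the full set, which
  \<open>card_le_of_comparable_le\<close> excludes.\<close>

lemma antichain_sum_le:
  fixes x \<beta> :: real
  assumes x: "x \<ge> 0" and \<beta>: "\<beta> \<ge> 1" "x \<le> \<beta> ^ (m div 2) * (\<beta> - 1)"
  shows "(\<Sum>I\<in>{I. I \<subseteq> Pow {1..2 * m} \<and> indep comparable I}. x ^ card I)
    \<le> (1 + x) ^ (2 * ((2 * m) choose m) + 1) * \<beta> ^ (2 ^ (2 * m))"
proof -
  let ?X = "{1..2 * m}"
  have "(\<Sum>I\<in>{I. I \<subseteq> Pow ?X \<and> indep comparable I}. x ^ card I)
      \<le> (1 + x) ^ (2 * ((2 * m) choose m) + 1) * \<beta> ^ card (Pow ?X)"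
  proof (rule hard_core_sum_le[where V = "Pow ?X" and d = "m div 2"])
    fix S :: "nat set set"
    assume S: "S \<subseteq> Pow ?X" "2 * ((2 * m) choose m) + 1 < card S"
    have fS: "finite S" using S(1) by (rule finite_subset) simp
    define F where "F = S - {?X}"
    have "card F > 2 * ((2 * m) choose m)"
      using S(2) card_Diff1_le[of S ?X] diff_card_le_card_Diff[of "{?X}" S] by (simp add: F_def)
    then have "\<exists>v\<in>F. m div 2 < card {u\<in>F. u \<subset> v \<or> v \<subset> u}"
      using card_le_of_comparable_le[of ?X F "m div 2"] S by (fastforce simp: F_def not_le)
    then obtain v where v: "v \<in> F" "m div 2 < card {u\<in>F. u \<subset> v \<or> v \<subset> u}" by blast
    have "card {u\<in>F. u \<subset> v \<or> v \<subset> u} \<le> card {u\<in>S. v \<subset> u \<or> u \<subset> v}"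
      using fS by (intro card_mono) (auto simp: F_def)
    then show "\<exists>v\<in>S. m div 2 \<le> card {u\<in>S. v \<subset> u \<or> u \<subset> v}"
      using v by (intro bexI[of _ v]) (auto simp: F_def)
  qed (use x \<beta> in auto)
  then show ?thesis by (simp add: card_Pow)
qed

text \<open>Any family of \<open>m\<close>-sets becomes a complex when all smaller non-empty sets
  are added.\<close>

lemma card_simplicial_complexes_ge:
  assumes "m > 0"
  shows "2 ^ ((2 * m) choose m) \<le> card (simplicial_complexes (2 * m))"
proof -
  let ?M = "{x. x \<subseteq> {1..2 * m} \<and> card x = m}"
  define L where "L = {x. x \<noteq> {} \<and> x \<subseteq> {1..2 * m} \<and> card x < m}"
  have inj: "inj_on (\<lambda>F. F \<union> L) (Pow ?M)"
    by (rule inj_on_inverseI[where g = "\<lambda>X. X \<inter> ?M"]) (auto simp: L_def)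
  have "(\<lambda>F. F \<union> L) ` Pow ?M \<subseteq> simplicial_complexes (2 * m)"
  proof safe
    fix F assume F: "F \<subseteq> ?M"
    have down: "y \<in> F \<union> L" if "x \<in> F \<union> L" "y \<noteq> {}" "y \<subseteq> x" for x y
    proof -
      have x: "x \<subseteq> {1..2 * m}" "card x \<le> m" using that F by (auto simp: L_def)
      have fx: "finite x" using x(1) by (rule finite_subset) simp
      show ?thesis
      proof (cases "y = x")
        case False
        then have "card y < card x" using that fx by (intro psubset_card_mono) auto
        then show ?thesis using x that by (auto simp: L_def)
      qed (use that in simp)
    qed
    have sub: "x \<noteq> {}" "x \<subseteq> {1..2 * m}" if x: "x \<in> F \<union> L" for x
    proof -
      have "x \<in> F \<Longrightarrow> card x = m \<and> x \<subseteq> {1..2 * m}" using F by blast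
      then show "x \<noteq> {}" "x \<subseteq> {1..2 * m}" using x assms by (auto simp: L_def)
    qed
    show "F \<union> L \<in> simplicial_complexes (2 * m)"
      using sub down by (rule simplicial_complexesI)
  qed
  then have "card (Pow ?M) \<le> card (simplicial_complexes (2 * m))"
    using card_mono[OF finite_simplicial_complexes] unfolding card_image[OF inj, symmetric] by blast
  moreover have "card ?M = (2 * m) choose m" using n_subsets[of "{1..2 * m}" m] by simp
  ultimately show ?thesis by (simp add: card_Pow)
qed

text \<open>One use of Bernoulli's inequality gives a power of order \<open>sqrt m\<close>, which
  the factor \<open>1 / (16 * sqrt m)\<close> reduces to a constant. Halving the exponent and
  squaring gives order \<open>m\<close> instead.\<close>

lemma hard_core_condition:
  fixes m :: nat
  assumes m: "m \<ge> 2 ^ 24"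
  shows "1 / 64 \<le> (1 + 1 / (16 * sqrt (real m))) ^ (m div 2) * (1 + 1 / (16 * sqrt (real m)) - 1)"
proof -
  define r where "r = sqrt (real m)"
  define y where "y = 1 / (16 * r)"
  have "real m \<ge> 16777216" using m by simp
  then have r: "r \<ge> 4096" "r ^ 2 = real m" unfolding r_def by (auto intro: real_le_rsqrt)
  have y: "y > 0" using r by (simp add: y_def)
  have "m \<ge> 16777216" using m by simp
  then have "m \<le> 8 * (m div 4)" by linarith
  then have m4: "real (m div 4) \<ge> real m / 8" by linarith
  have "r / 128 = real m / 8 * y" using r by (simp add: y_def field_simps power2_eq_square)
  also have "\<dots> \<le> real (m div 4) * y" using m4 y by (intro mult_right_mono) auto
  also have "\<dots> \<le> (1 + y) ^ (m div 4)" using Bernoulli_inequality[of y "m div 4"] y by simp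
  finally have "(r / 128) ^ 2 \<le> ((1 + y) ^ (m div 4)) ^ 2" using r by (intro power_mono) auto
  also have "\<dots> = (1 + y) ^ (2 * (m div 4))" by (simp add: power_mult[symmetric] mult.commute)
  also have "\<dots> \<le> (1 + y) ^ (m div 2)" using y by (intro power_increasing) auto
  finally have "(r / 128) ^ 2 * y \<le> (1 + y) ^ (m div 2) * y" using y by (intro mult_right_mono) auto
  moreover have "(r / 128) ^ 2 * y = r / 262144" using r by (simp add: y_def field_simps power2_eq_square)
  \<comment> \<open>The bound \<open>r / 262144\<close> reaches \<open>1 / 64\<close> exactly at
    \<open>r = 4096\<close>, whence the threshold \<open>2 ^ 24\<close> for
    \<open>m\<close>.\<close>
  ultimately show "1 / 64 \<le> (1 + 1 / (16 * sqrt (real m))) ^ (m div 2) * (1 + 1 / (16 * sqrt (real m)) - 1)"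
    using r by (simp add: y_def r_def)
qed

text \<open>Each factor is bounded by an exponential in \<open>N\<close>; their product stays far
  enough below \<open>2 ^ N\<close> to absorb \<open>sqrt N\<close>.\<close>

lemma few_faces_estimate:
  fixes m N s :: nat
  assumes m: "m > 0" and N: "N = (2 * m) choose m" and s: "100 * s \<le> N"
  shows "64 ^ s * ((65 / 64) ^ (2 * N + 1) * (1 + 1 / (16 * sqrt (real m))) ^ (2 ^ (2 * m)))
    * sqrt (real N) \<le> 12 * 2 ^ N"
proof -
  define r where "r = sqrt (real m)"
  have r: "r > 0" using m by (simp add: r_def)
  have N0: "N > 0" using N by simp
  have pw: "(1 + z) ^ k \<le> exp (real k * z)" if "z \<ge> 0" for z :: real and k
    using power_mono[OF exp_ge_add_one_self[of z], of k] that by (simp add: exp_of_nat_mult)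
  have "(2::real) ^ (6 * s) \<le> exp (real (6 * s) * 1)" using pw[of 1 "6 * s"] by simp
  then have 1: "(64::real) ^ s \<le> exp (6 * real N / 100)"
  proof -
    have "(64::real) ^ s = 2 ^ (6 * s)" by (simp add: power_mult)
    also have "\<dots> \<le> exp (real (6 * s) * 1)" by fact
    also have "\<dots> \<le> exp (6 * real N / 100)" using s by (simp only: exp_le_cancel_iff)
    finally show ?thesis .
  qed
  have "(65 / 64 :: real) = 1 + 1 / 64" "(2 * real N + 1) / 64 = real (2 * N + 1) * (1 / 64)" by simp_all
  then have 2: "(65 / 64 :: real) ^ (2 * N + 1) \<le> exp ((2 * real N + 1) / 64)"
    using pw[of "1 / 64" "2 * N + 1"] by (simp only: zero_le_divide_1_iff zero_le_numeral)
  have "real (2 ^ (2 * m)) * (1 / (16 * r)) \<le> (2 * r * real N) * (1 / (16 * r))"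
    using power_four_le_sqrt_mult_central_binomial[OF m] r
    by (intro mult_right_mono) (auto simp: N r_def power_mult)
  also have "\<dots> = real N / 8" using r by simp
  finally have "exp (real (2 ^ (2 * m)) * (1 / (16 * r))) \<le> exp (real N / 8)"
    by (simp only: exp_le_cancel_iff)
  moreover have "(1 + 1 / (16 * r)) ^ (2 ^ (2 * m)) \<le> exp (real (2 ^ (2 * m)) * (1 / (16 * r)))"
    using r by (intro pw) simp
  ultimately have 3: "(1 + 1 / (16 * r)) ^ (2 ^ (2 * m)) \<le> exp (real N / 8)"
    by (rule order_trans[rotated])
  have "64 ^ s * ((65 / 64) ^ (2 * N + 1) * (1 + 1 / (16 * r)) ^ (2 ^ (2 * m)))
      \<le> exp (6 * real N / 100) * (exp ((2 * real N + 1) / 64) * exp (real N / 8))"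
    using 1 2 3 r by (intro mult_mono) auto
  also have "\<dots> = exp (6 * real N / 100 + ((2 * real N + 1) / 64 + real N / 8))"
    by (simp only: exp_add)
  \<comment> \<open>The coefficients of \<open>N\<close> sum to
    \<open>0.06 + 0.03125 + 0.125\<close>, less than \<open>1 / 4\<close>. Writing this as
    \<open>1 / 2 - 1 / 4\<close> isolates \<open>exp (N / 2) \<le> 2 ^ N\<close> and leaves decay to
    spare.\<close>
  also have "\<dots> \<le> exp (1 + (- (real N / 4) + real N / 2))"
    using N0 unfolding exp_le_cancel_iff by (simp add: field_simps)
  also have "\<dots> = exp 1 * exp (- (real N / 4)) * exp (real N / 2)"
    by (simp only: exp_add mult.assoc)
  also have "\<dots> \<le> 3 * (4 / real N) * 2 ^ N"
  proof (intro mult_mono)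
    show "exp 1 \<le> (3::real)" by (rule exp_le)
    have "real N / 4 \<le> exp (real N / 4)" using exp_ge_add_one_self[of "real N / 4"] by linarith
    then show "exp (- (real N / 4)) \<le> 4 / real N"
      using N0 by (simp add: exp_minus field_simps)
    have "exp (1 / 2 :: real) \<le> 2"
    proof (rule power2_le_imp_le)
      show "(exp (1 / 2 :: real))\<^sup>2 \<le> 2\<^sup>2" using exp_le by (simp flip: exp_of_nat_mult)
    qed simp
    then have "exp (1 / 2 :: real) ^ N \<le> 2 ^ N" by (intro power_mono) auto
    then show "exp (real N / 2) \<le> 2 ^ N" by (simp flip: exp_of_nat_mult)
  qed (use N0 in auto)
  finally have "64 ^ s * ((65 / 64) ^ (2 * N + 1) * (1 + 1 / (16 * r)) ^ (2 ^ (2 * m))) * sqrt (real N)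
      \<le> 3 * (4 / real N) * 2 ^ N * sqrt (real N)"
    by (rule mult_right_mono) simp
  also have "\<dots> = 12 * 2 ^ N * (sqrt (real N) / real N)" by simp
  also have "\<dots> \<le> 12 * 2 ^ N * 1"
  proof (intro mult_left_mono)
    have "sqrt (real N) * 1 \<le> sqrt (real N) * sqrt (real N)" using N0 by (intro mult_left_mono) auto
    then show "sqrt (real N) / real N \<le> 1" using N0 by (simp add: field_simps)
  qed simp
  finally show ?thesis by (simp add: r_def)
qed

section \<open>The Euler characteristic of a random complex\<close>

lemma euler_char_concentration:
  fixes m N :: nat and k :: int
  assumes m: "m \<ge> 2 ^ 24" and N: "N = (2 * m) choose m"
  shows "real (card {\<Delta>\<in>simplicial_complexes (2 * m). euler_char \<Delta> = k}) * sqrt (real N)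
    \<le> 42 * real (card (simplicial_complexes (2 * m)))"
proof -
  let ?S = "simplicial_complexes (2 * m)"
  define T where "T = real (card ?S)"
  define s where "s = N div 100"
  \<comment> \<open>Of more than \<open>s\<close> maximal faces, at least half have the same parity,
    and \<open>t\<close> is \<open>(s + 1) / 2\<close> rounded up.\<close>
  define t where "t = (s + 2) div 2"
  define \<beta> where "\<beta> = 1 + 1 / (16 * sqrt (real m))"
  define A where "A = {\<Delta>\<in>?S. euler_char \<Delta> = k}"
  define B where "B = {\<Delta>\<in>?S. card (maximal_faces \<Delta>) \<le> s}"
  define C where "C b = {\<Delta>\<in>?S. euler_char \<Delta> = k \<and> t \<le> card (maximal_faces \<Delta> \<inter> parity_class b)}" for b
  have "(0::nat) < 2 ^ 24" by simp
  then have m0: "m > 0" using m by (rule less_le_trans)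
  have fin: "finite ?S" by (rule finite_simplicial_complexes)
  have "A \<subseteq> B \<union> (C True \<union> C False)"
  proof
    fix \<Delta> assume \<Delta>: "\<Delta> \<in> A"
    let ?M = "maximal_faces \<Delta>"
    have "?M = (?M \<inter> parity_class True) \<union> (?M \<inter> parity_class False)"
      by (auto simp: parity_class_def)
    then have "card ?M \<le> card (?M \<inter> parity_class True) + card (?M \<inter> parity_class False)"
      by (metis card_Un_le)
    then have "card ?M \<le> s \<or> t \<le> card (?M \<inter> parity_class True) \<or> t \<le> card (?M \<inter> parity_class False)"
      unfolding t_def by linarith
    then show "\<Delta> \<in> B \<union> (C True \<union> C False)"
      using \<Delta> unfolding A_def B_def C_def by blast
  qed
  then have "card A \<le> card (B \<union> (C True \<union> C False))"
    using fin by (intro card_mono) (auto simp: B_def C_def)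
  also have "\<dots> \<le> card B + (card (C True) + card (C False))"
    by (meson add_left_mono card_Un_le order_trans)
  finally have "real (card A) \<le> real (card B) + (real (card (C True)) + real (card (C False)))"
    by linarith
  then have "real (card A) * sqrt (real N)
      \<le> (real (card B) + (real (card (C True)) + real (card (C False)))) * sqrt (real N)"
    by (rule mult_right_mono) simp
  also have "\<dots> = real (card B) * sqrt (real N)
      + (real (card (C True)) * sqrt (real N) + real (card (C False)) * sqrt (real N))"
    by (simp only: distrib_right)
  also have "\<dots> \<le> 12 * T + (15 * T + 15 * T)"
  proof (intro add_mono)
    have "real (card B) * (1 / 64) ^ s \<le> (\<Sum>I\<in>{I. I \<subseteq> Pow {1..2 * m} \<and> indep comparable I}. (1 / 64) ^ card I)"
      unfolding B_def by (rule card_few_maximal_faces_le) simp_all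
    also have "\<dots> \<le> (1 + 1 / 64) ^ (2 * ((2 * m) choose m) + 1) * \<beta> ^ (2 ^ (2 * m))"
    proof (rule antichain_sum_le)
      show "1 / 64 \<le> \<beta> ^ (m div 2) * (\<beta> - 1)"
        using hard_core_condition[OF m] unfolding \<beta>_def by blast
    qed (simp_all add: \<beta>_def)
    finally have "real (card B) * (1 / 64) ^ s \<le> (65 / 64) ^ (2 * N + 1) * \<beta> ^ (2 ^ (2 * m))"
      unfolding N[symmetric] by simp
    then have "64 ^ s * (real (card B) * (1 / 64) ^ s) \<le> 64 ^ s * ((65 / 64) ^ (2 * N + 1) * \<beta> ^ (2 ^ (2 * m)))"
      by (rule mult_left_mono) simp
    also have "64 ^ s * (real (card B) * (1 / 64) ^ s) = real (card B)"
      by (simp add: power_divide)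
    finally have "real (card B) * sqrt (real N)
        \<le> 64 ^ s * ((65 / 64) ^ (2 * N + 1) * \<beta> ^ (2 ^ (2 * m))) * sqrt (real N)"
      by (rule mult_right_mono) simp
    also have "\<dots> \<le> 12 * 2 ^ N"
      unfolding \<beta>_def using m0 N by (rule few_faces_estimate) (simp add: s_def)
    also have "2 ^ N \<le> T"
    proof -
      have "real (2 ^ N) \<le> T"
        unfolding T_def N of_nat_le_iff using m0 by (rule card_simplicial_complexes_ge)
      then show ?thesis by simp
    qed
    finally show "real (card B) * sqrt (real N) \<le> 12 * T" by simp
  next
    \<comment> \<open>In fact \<open>N < 100 * (s + 1) \<le> 200 * t\<close>; 225 is a convenient
      square.\<close>
    have "N \<le> 225 * t" unfolding t_def s_def by linarith
    then have "sqrt (real N) \<le> sqrt (225 * real t)" by simp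
    also have "\<dots> = 15 * sqrt (real t)" by (simp add: real_sqrt_mult)
    finally have Nt: "sqrt (real N) \<le> 15 * sqrt (real t)" .
    have C: "real (card (C b)) * sqrt (real N) \<le> 15 * T" for b
    proof -
      have "real (card (C b)) * sqrt (real N) \<le> real (card (C b)) * (15 * sqrt (real t))"
        using Nt by (rule mult_left_mono) simp
      also have "\<dots> = 15 * (real (card (C b)) * sqrt (real t))" by simp
      also have "\<dots> \<le> 15 * T"
        unfolding C_def T_def by (intro mult_left_mono card_euler_char_le) simp
      finally show ?thesis .
    qed
    show "real (card (C True)) * sqrt (real N) \<le> 15 * T" by (rule C)
    show "real (card (C False)) * sqrt (real N) \<le> 15 * T" by (rule C)
  qed
  also have "\<dots> = 42 * T" by simp
  finally show ?thesis by (simp only: A_def T_def)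
qed

lemma prob_uniform_complex:
  "measure_pmf.prob (uniform_complex n) {\<Delta>. euler_char \<Delta> = k}
    = real (card {\<Delta>\<in>simplicial_complexes n. euler_char \<Delta> = k}) / real (card (simplicial_complexes n))"
  unfolding uniform_complex_def
  by (subst measure_pmf_of_set[OF simplicial_complexes_nonempty finite_simplicial_complexes])
    (simp add: Int_def)

lemma prob_euler_char_le:
  fixes m :: nat and k :: int
  assumes m: "m \<ge> 2 ^ 24"
  shows "measure_pmf.prob (uniform_complex (2 * m)) {\<Delta>. euler_char \<Delta> = k}
    \<le> 84 * real (2 * m) powr (1 / 4) * (1 / 2 ^ m)" (is "?p \<le> 84 * ?q * _")
proof -
  define N where "N = (2 * m) choose m"
  have "(0::nat) < 2 ^ 24" by simp
  then have m0: "m > 0" using m by (rule less_le_trans)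
  have T: "real (card (simplicial_complexes (2 * m))) > 0"
    using finite_simplicial_complexes simplicial_complexes_nonempty by (simp add: card_gt_0_iff)
  have p: "?p * sqrt (real N) \<le> 42"
    using euler_char_concentration[OF m N_def, of k] T unfolding prob_uniform_complex
    by (simp add: field_simps)
  have q: "?q ^ 2 = sqrt (real (2 * m))"
    using m0 by (simp add: powr_powr powr_half_sqrt flip: powr_realpow)
  have "(2 ^ m)\<^sup>2 = (4::real) ^ m" by (simp flip: power_mult power_mult_distrib add: power2_eq_square)
  also have "\<dots> \<le> 2 * sqrt (real m) * real N"
    unfolding N_def using m0 by (rule power_four_le_sqrt_mult_central_binomial)
  \<comment> \<open>The constant is enlarged so that the right-hand side becomes a perfect
    square.\<close>
  also have "\<dots> \<le> 4 * sqrt (real (2 * m)) * real N"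
    by (intro mult_right_mono mult_mono) auto
  also have "\<dots> = (2 * ?q * sqrt (real N))\<^sup>2"
    unfolding power_mult_distrib q by simp
  finally have "2 ^ m \<le> 2 * ?q * sqrt (real N)"
    by (rule power2_le_imp_le) simp
  then have "?p * 2 ^ m \<le> ?p * (2 * ?q * sqrt (real N))"
    by (rule mult_left_mono) simp
  also have "\<dots> = 2 * ?q * (?p * sqrt (real N))" by (simp only: mult_ac)
  also have "\<dots> \<le> 2 * ?q * 42" by (intro mult_left_mono p) simp
  finally have "?p * 2 ^ m \<le> 84 * ?q" by simp
  then show ?thesis by (simp add: field_simps)
qed

theorem theorem12:
  "\<exists>c::real. \<forall>n::nat. even n \<and> n > 0 \<longrightarrow>
     (\<forall>k::nat. measure_pmf.prob (uniform_complex n) {\<Delta>. euler_char \<Delta> = int k}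
        \<le> c * real n powr (1/4) * 2 powr (- real n / 2))"
proof -
  \<comment> \<open>Not a local definition: unfolded, the constant \<open>2 ^ M\<close> would be evaluated by the simplifier.\<close>
  obtain M :: nat where M: "M = 2 ^ 24" by blast
  have "measure_pmf.prob (uniform_complex n) {\<Delta>. euler_char \<Delta> = int k}
      \<le> (84 + 2 ^ M) * real n powr (1/4) * 2 powr (- real n / 2)" (is "?p \<le> _")
    if n: "even n" "n > 0" for n k :: nat
  proof -
    obtain m where m: "n = 2 * m" using n(1) by (elim evenE)
    define q where "q = real n powr (1 / 4)"
    \<comment> \<open>Positivity of \<open>n\<close> is essential: at \<open>n = 0\<close> the
      factor \<open>n powr (1/4)\<close> is 0, while the only complex is empty and has Euler
      characteristic 0.\<close>
    have q: "q \<ge> 1" unfolding q_def using n(2) by (intro ge_one_powr_ge_zero) auto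
    have "- real n / 2 = - real m" using m by simp
    then have "2 powr (- real n / 2) = 1 / 2 powr real m" by (simp only: powr_minus_divide)
    also have "\<dots> = 1 / 2 ^ m" by (subst powr_realpow) simp_all
    finally have "2 powr (- real n / 2) = (1::real) / 2 ^ m" .
    moreover have "?p \<le> (84 + 2 ^ M) * q * (1 / 2 ^ m)"
    proof (cases "m \<ge> M")
      case True
      then have "?p \<le> 84 * q * (1 / 2 ^ m)"
        using prob_euler_char_le[of m "int k"] unfolding q_def m M by blast
      also have "\<dots> \<le> (84 + 2 ^ M) * q * (1 / 2 ^ m)"
        using q by (intro mult_right_mono) auto
      finally show ?thesis .
    next
      case False
      \<comment> \<open>For the finitely many small \<open>m\<close> the summand
        \<open>2 ^ M\<close> of the constant makes the bound exceed 1.\<close>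
      have "?p \<le> 1" by (rule measure_pmf.prob_le_1)
      also have "1 \<le> 2 ^ M * (1 / (2::real) ^ m)"
        using False by (simp add: field_simps)
      also have "\<dots> \<le> (84 + 2 ^ M) * q * (1 / 2 ^ m)"
      proof (rule mult_right_mono)
        have "(2::real) ^ M * 1 \<le> (84 + 2 ^ M) * q" using q by (intro mult_mono) auto
        then show "(2::real) ^ M \<le> (84 + 2 ^ M) * q" by simp
      qed simp
      finally show ?thesis .
    qed
    ultimately show ?thesis by (simp only: q_def)
  qed
  then show ?thesis by blast
qed

end
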